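(* Let $\ell\ge 2$ be an integer. If $G$ is a finite simple $K_{1,\ell+1}$-free graph, then $\chi_{\mathrm{o}}(G) \le \frac{2\ell-1}{\ell}\Delta(G) + 1+\left\lceil \sqrt{\frac{2\Delta(G)}{\ell}+1}\right\rceil$.
   Context: $K_{1,\ell+1}$-free means $G$ has no induced subgraph isomorphic to the star $K_{1,\ell+1}$. An odd $k$-coloring of $G$ is a proper $k$-coloring such that every vertex of positive degree has some color appearing an odd number of times on its neighborhood; $\chi_{\mathrm{o}}(G)$ is the minimum $k$ for which $G$ has an odd $k$-coloring. $\Delta(G)$ is the maximum degree. *)

theory Defs
  imports Complex_Main "Graph_Theory.Graph_Theory"
begin

text \<open>A finite simple graph is a symmetric digraph without loops and parallel arcs
  (locale \<^locale>\<open>graph\<close>): an edge $uv$ is the pair of arcs $(u,v)$, $(v,u)$, and the degree of a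
  vertex is its out-degree.\<close>

definition neighborhood :: "('a, 'b) pre_digraph \<Rightarrow> 'a \<Rightarrow> 'a set" where
  "neighborhood G v = {u. v \<rightarrow>\<^bsub>G\<^esub> u}"

text \<open>The inserted \<open>0\<close> only matters for the graph without vertices.\<close>

definition max_degree :: "('a, 'b) pre_digraph \<Rightarrow> nat" where
  "max_degree G = Max (insert 0 (out_degree G ` verts G))"

definition star_free :: "nat \<Rightarrow> ('a, 'b) pre_digraph \<Rightarrow> bool" where
  "star_free n G \<longleftrightarrow> \<not> (\<exists>H. induced_subgraph H G \<and> complete_bipartite_digraph 1 n H)"

definition proper_coloring :: "('a, 'b) pre_digraph \<Rightarrow> nat \<Rightarrow> ('a \<Rightarrow> nat) \<Rightarrow> bool" where
  "proper_coloring G k c \<longleftrightarrow>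
     (\<forall>v \<in> verts G. c v < k) \<and> (\<forall>u v. u \<rightarrow>\<^bsub>G\<^esub> v \<longrightarrow> c u \<noteq> c v)"

definition odd_coloring :: "('a, 'b) pre_digraph \<Rightarrow> nat \<Rightarrow> ('a \<Rightarrow> nat) \<Rightarrow> bool" where
  "odd_coloring G k c \<longleftrightarrow> proper_coloring G k c \<and>
     (\<forall>v \<in> verts G. 0 < out_degree G v \<longrightarrow>
        (\<exists>i < k. odd (card {u \<in> neighborhood G v. c u = i})))"

definition odd_chromatic_number :: "('a, 'b) pre_digraph \<Rightarrow> nat" where
  "odd_chromatic_number G = (LEAST k. \<exists>c. odd_coloring G k c)"

text \<open>The minimum is attained: colour all vertices differently.\<close>

lemma (in graph) ex_odd_coloring: "\<exists>k c. odd_coloring G k c"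
proof -
  obtain c :: "'a \<Rightarrow> nat" and k where c: "c ` verts G = {i. i < k}" "inj_on c (verts G)"
    using finite_imp_inj_to_nat_seg[OF finite_verts] by blast
  have in_verts: "u \<in> verts G \<and> v \<in> verts G" if "u \<rightarrow> v" for u v
    using that by (auto simp: arcs_ends_conv)
  have "odd_coloring G k c"
    unfolding odd_coloring_def proper_coloring_def
  proof (intro conjI ballI allI impI)
    show "c v < k" if "v \<in> verts G" for v using c that by blast
    show "c u \<noteq> c v" if "u \<rightarrow> v" for u v
      using c(2) in_verts[OF that] adj_not_same that by (auto dest: inj_onD)
  next
    fix v assume "v \<in> verts G" "0 < out_degree G v"
    then obtain e where "e \<in> out_arcs G v"
      by (metis card_gt_0_iff ex_in_conv out_degree_def)
    then obtain u where u: "v \<rightarrow> u" by (auto simp: arcs_ends_conv)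
    have "{w \<in> neighborhood G v. c w = c u} = {u}"
      using u in_verts c(2) by (auto simp: neighborhood_def dest: inj_onD)
    moreover have "c u < k" using c(1) in_verts[OF u] by blast
    ultimately show "\<exists>i<k. odd (card {w \<in> neighborhood G v. c w = i})"
      by (intro exI[of _ "c u"]) simp
  qed
  then show ?thesis by blast
qed

end

theory Submission
  imports Defs
begin

text \<open>Call a vertex bad if every color occurs an even number of times on its nonempty
  neighborhood, and take a proper \<open>k\<close>-coloring with the fewest bad vertices. Let \<open>w\<close> be adjacent to
  a bad vertex. Recoloring \<open>w\<close> with a color \<open>a\<close> cures the bad neighbors of \<open>w\<close>, so every \<open>a\<close> missing
  from the neighborhood of \<open>w\<close> must make some neighbor of \<open>w\<close> bad, and different \<open>a\<close> spoil different
  neighbors. This gives \<open>k \<le> 2\<Delta>\<close>. If \<open>a\<close> spoils exactly one neighbor \<open>u\<close>, the recolored graph is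
  again optimal with \<open>u\<close> bad. The vertices \<open>u\<close> that arise in this way are pairwise nonadjacent,
  since they see at most about \<open>\<Delta>/2\<close> colors; hence there are at most \<open>\<ell>\<close> of them, every other missing
  color spoils at least two neighbors, and \<open>2k \<le> 3\<Delta> + \<ell>\<close>. So a larger \<open>k\<close> admits an odd coloring;
  the first bound settles \<open>\<Delta> \<le> \<ell>\<close> and the second one \<open>\<Delta> > \<ell>\<close>.\<close>

section \<open>Colors of odd multiplicity\<close>

definition odd_colors :: "('a \<Rightarrow> 'c) \<Rightarrow> 'a set \<Rightarrow> 'c set" where
  "odd_colors c A = {i. odd (card {u \<in> A. c u = i})}"

lemma odd_colors_cong:
  assumes "\<And>u. u \<in> A \<Longrightarrow> c u = c' u"
  shows "odd_colors c A = odd_colors c' A"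
proof -
  have "{u \<in> A. c u = i} = {u \<in> A. c' u = i}" for i
    using assms by auto
  then show ?thesis by (simp add: odd_colors_def)
qed

text \<open>Adding \<open>w\<close> flips the parity of the color \<open>c w\<close> and of no
  other, so all parities become even exactly when \<open>c w\<close> was the only odd one.\<close>

lemma odd_colors_insert_empty_iff:
  assumes "finite A" "w \<notin> A"
  shows "odd_colors c (insert w A) = {} \<longleftrightarrow> odd_colors c A = {c w}"
proof -
  have "odd (card {u \<in> insert w A. c u = i}) \<longleftrightarrow> (odd (card {u \<in> A. c u = i}) \<longleftrightarrow> i \<noteq> c w)" for i
  proof (cases "i = c w")
    case True
    then have "{u \<in> insert w A. c u = i} = insert w {u \<in> A. c u = i}" by auto
    then show ?thesis using assms True by simp
  next
    case False
    then have "{u \<in> insert w A. c u = i} = {u \<in> A. c u = i}" by auto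
    then show ?thesis using False by simp
  qed
  then show ?thesis by (auto simp: odd_colors_def set_eq_iff)
qed

text \<open>A color that occurs evenly occurs at least twice; one that occurs oddly may occur once
  and is topped up by 1. So a vertex with few odd colors sees only about half as many colors as it
  has neighbors.\<close>

lemma card_image_odd_colors_le:
  assumes "finite A"
  shows "2 * card (c ` A) \<le> card A + card (odd_colors c A)"
proof -
  have pos: "card {u \<in> A. c u = i} > 0" if "i \<in> c ` A" for i
    using that assms by (auto simp: card_gt_0_iff)
  have sub: "odd_colors c A \<subseteq> c ` A"
  proof
    fix i assume "i \<in> odd_colors c A"
    then have "{u \<in> A. c u = i} \<noteq> {}" unfolding odd_colors_def by force
    then show "i \<in> c ` A" by auto
  qed
  have "2 * card (c ` A) = (\<Sum>i\<in>c ` A. 2)" by simp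
  also have "\<dots> \<le> (\<Sum>i\<in>c ` A. card {u \<in> A. c u = i} + (if i \<in> odd_colors c A then 1 else 0))"
  proof (rule sum_mono)
    fix i assume "i \<in> c ` A"
    from pos[OF this] show "2 \<le> card {u \<in> A. c u = i} + (if i \<in> odd_colors c A then 1 else 0)"
      by (cases "card {u \<in> A. c u = i} = 1") (auto simp: odd_colors_def)
  qed
  also have "\<dots> = (\<Sum>i\<in>c ` A. card {u \<in> A. c u = i}) + card (odd_colors c A)"
    using sub assms by (simp add: sum.distrib sum.If_cases Int_absorb1)
  also have "(\<Sum>i\<in>c ` A. card {u \<in> A. c u = i}) = card A"
    unfolding card_eq_sum by (rule sum.image_gen[OF assms, symmetric])
  finally show ?thesis .
qed

section \<open>Neighborhoods\<close>

context graph
begin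

lemma neighborhood_iff: "u \<in> neighborhood G v \<longleftrightarrow> v \<rightarrow> u"
  by (simp add: neighborhood_def)

lemma neighborhood_subset: "neighborhood G v \<subseteq> verts G"
  by (auto simp: neighborhood_def)

lemma finite_neighborhood [simp]: "finite (neighborhood G v)"
  using finite_subset[OF neighborhood_subset] by simp

lemma neighborhood_sym: "u \<in> neighborhood G v \<longleftrightarrow> v \<in> neighborhood G u"
  using arcs_ends_symmetric[OF sym_arcs] by (auto simp: neighborhood_def)

lemma not_in_own_neighborhood [simp]: "v \<notin> neighborhood G v"
  using adj_not_same by (auto simp: neighborhood_def)

lemma card_neighborhood: "card (neighborhood G v) = out_degree G v"
proof -
  have "neighborhood G v = head G ` out_arcs G v"
    by (auto simp: neighborhood_def arcs_ends_conv)
  moreover have "inj_on (head G) (out_arcs G v)"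
    using no_multi_arcs by (intro inj_onI) (auto simp: arc_to_ends_def)
  ultimately show ?thesis by (simp add: out_degree_def card_image)
qed

lemma card_neighborhood_le: "card (neighborhood G v) \<le> max_degree G"
proof (cases "v \<in> verts G")
  case True
  then show ?thesis by (auto simp: max_degree_def card_neighborhood intro!: Max_ge)
next
  case False
  then have "neighborhood G v = {}" by (auto simp: neighborhood_def)
  then show ?thesis by simp
qed

text \<open>Any \<open>l + 1\<close> elements of \<open>I\<close> would induce, together with
  \<open>w\<close>, a forbidden star centered at \<open>w\<close>.\<close>

lemma star_free_card_le:
  assumes star: "star_free (l + 1) G"
    and I: "I \<subseteq> neighborhood G w" "\<And>u u'. u \<in> I \<Longrightarrow> u' \<in> I \<Longrightarrow> u' \<notin> neighborhood G u"
  shows "card I \<le> l"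
proof (rule ccontr)
  assume "\<not> card I \<le> l"
  then obtain J where J: "J \<subseteq> I" "card J = l + 1"
    using obtain_subset_with_card_n[of "l + 1" I] by auto
  then obtain u where "u \<in> J" by (cases "J = {}") auto
  then have "u \<in> neighborhood G w" using J(1) I(1) by blast
  then have "w \<in> neighborhood G u" by (simp add: neighborhood_sym)
  then have "w \<in> verts G" using neighborhood_subset by blast
  moreover have "J \<subseteq> verts G" using J(1) I(1) neighborhood_subset by blast
  ultimately have sub: "insert w J \<subseteq> verts G" by blast
  let ?H = "G \<restriction> insert w J"
  have "complete_bipartite_digraph 1 (l + 1) ?H"
    unfolding complete_bipartite_digraph_def
  proof (intro conjI exI)
    show "graph ?H"
      using digraphI_induced[OF induced_induce[OF sub]]
        induced_graph_imp_symmetric[OF sym_arcs induced_induce[OF sub]]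
      by (rule digraph.graphI)
    show "verts ?H = {w} \<union> J" by simp
    show "{w} \<inter> J = {}" using J I by auto
    show "card {w} = 1" "card J = l + 1" using J by auto
    have arcs: "(u, u') \<in> arcs_ends ?H \<longleftrightarrow> u \<in> insert w J \<and> u' \<in> insert w J \<and> u' \<in> neighborhood G u" for u u'
      by (auto simp: arcs_ends_conv neighborhood_def induce_subgraph_def)
    have center: "u \<in> neighborhood G w" "w \<in> neighborhood G u" if "u \<in> J" for u
      using that J(1) I(1) neighborhood_sym[of u w] by auto
    have indep: "u' \<notin> neighborhood G u" if "u \<in> J" "u' \<in> J" for u u'
      using that J(1) I(2) by auto
    have "(u, u') \<in> arcs_ends ?H \<longleftrightarrow> (u, u') \<in> {w} \<times> J \<union> J \<times> {w}" for u u'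
      using center indep unfolding arcs by (cases "u = w"; cases "u' = w") auto
    then show "arcs_ends ?H = {w} \<times> J \<union> J \<times> {w}"
      by (intro set_eqI) (simp only: split_paired_all)
  qed
  with induced_induce[OF sub] show False using star unfolding star_free_def by blast
qed

section \<open>Recoloring a vertex\<close>

lemma proper_coloring_recolor:
  assumes "proper_coloring G k c" "a < k" "a \<notin> c ` neighborhood G w"
  shows "proper_coloring G k (c(w := a))"
proof -
  have "x \<in> neighborhood G w" if "x \<rightarrow> w \<or> w \<rightarrow> x" for x
    using that neighborhood_sym by (auto simp: neighborhood_iff)
  moreover have "\<not> w \<rightarrow> w" using adj_not_same by blast
  ultimately show ?thesis
    using assms unfolding proper_coloring_def by (auto simp: image_iff)
qed

text \<open>Greedy coloring: the new vertex avoids the colors on its whole neighborhood, colored or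
  not, which still excludes at most \<open>max_degree G\<close> of them.\<close>

lemma ex_proper_coloring:
  assumes "max_degree G < k"
  shows "\<exists>c. proper_coloring G k c"
proof -
  have "\<exists>c. (\<forall>v. c v < k) \<and> (\<forall>u\<in>S. \<forall>v\<in>S. u \<rightarrow> v \<longrightarrow> c u \<noteq> c v)" if "finite S" for S
    using that
  proof induction
    case empty
    then show ?case using assms by (intro exI[of _ "\<lambda>_. 0"]) auto
  next
    case (insert w S)
    then obtain c where c: "\<forall>v. c v < k" "\<forall>u\<in>S. \<forall>v\<in>S. u \<rightarrow> v \<longrightarrow> c u \<noteq> c v" by blast
    have "card (c ` neighborhood G w) < card {..<k}"
      using card_image_le[OF finite_neighborhood, of c w] card_neighborhood_le[of w] assms by simp
    then obtain a where a: "a < k" "a \<notin> c ` neighborhood G w"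
      by (metis card_mono finite_imageI finite_neighborhood lessThan_iff linorder_not_le subsetI)
    have "x \<in> neighborhood G w" if "x \<rightarrow> w \<or> w \<rightarrow> x" for x
      using that neighborhood_sym by (auto simp: neighborhood_iff)
    moreover have "\<not> w \<rightarrow> w" using adj_not_same by blast
    ultimately show ?case
      using c a by (intro exI[of _ "c(w := a)"]) (auto simp: image_iff)
  qed
  from this[OF finite_verts] obtain c
    where c: "\<forall>v. c v < k" "\<forall>u\<in>verts G. \<forall>v\<in>verts G. u \<rightarrow> v \<longrightarrow> c u \<noteq> c v"
    by blast
  then have "proper_coloring G k c"
    unfolding proper_coloring_def using adj_in_verts by blast
  then show ?thesis by blast
qed

definition bad :: "('a \<Rightarrow> 'c) \<Rightarrow> 'a set" where
  "bad c = {v \<in> verts G. neighborhood G v \<noteq> {} \<and> odd_colors c (neighborhood G v) = {}}"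

text \<open>These are the neighbors of \<open>w\<close> that are bad once \<open>w\<close> has color
  \<open>a\<close>. Leaving out \<open>w\<close> makes the set independent of the present color of
  \<open>w\<close>.\<close>

definition critical :: "('a \<Rightarrow> 'c) \<Rightarrow> 'a \<Rightarrow> 'c \<Rightarrow> 'a set" where
  "critical c w a = {u \<in> neighborhood G w. odd_colors c (neighborhood G u - {w}) = {a}}"

lemma finite_bad [simp]: "finite (bad c)"
  by (simp add: bad_def)

lemma finite_critical [simp]: "finite (critical c w a)"
  by (simp add: critical_def)

lemma odd_coloring_iff_bad_empty:
  "odd_coloring G k c \<longleftrightarrow> proper_coloring G k c \<and> bad c = {}"
proof -
  have "(\<exists>i<k. odd (card {u \<in> neighborhood G v. c u = i})) \<longleftrightarrow> odd_colors c (neighborhood G v) \<noteq> {}"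
    if "proper_coloring G k c" for v
  proof -
    \<comment> \<open>An odd count is nonzero, so some vertex has color \<open>i\<close>, and
      properness bounds it.\<close>
    have "i < k" if "odd (card {u \<in> neighborhood G v. c u = i})" for i
    proof -
      have "{u \<in> neighborhood G v. c u = i} \<noteq> {}" using that by force
      then show ?thesis
        using \<open>proper_coloring G k c\<close> neighborhood_subset unfolding proper_coloring_def by blast
    qed
    then show ?thesis by (auto simp: odd_colors_def)
  qed
  moreover have "0 < out_degree G v \<longleftrightarrow> neighborhood G v \<noteq> {}" for v
    by (simp add: card_gt_0_iff flip: card_neighborhood)
  moreover have "bad c = {} \<longleftrightarrow> (\<forall>v\<in>verts G. neighborhood G v \<noteq> {} \<longrightarrow> odd_colors c (neighborhood G v) \<noteq> {})"
    by (auto simp: bad_def)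
  ultimately show ?thesis
    by (cases "proper_coloring G k c") (simp_all add: odd_coloring_def)
qed

text \<open>Only the neighbors of \<open>w\<close> notice the change, and for them \<open>w\<close>
  is reinserted with color \<open>a\<close> into the rest of their neighborhood.\<close>

lemma bad_recolor: "bad (c(w := a)) = (bad c - neighborhood G w) \<union> critical c w a"
proof -
  have "u \<in> bad (c(w := a)) \<longleftrightarrow> u \<in> (bad c - neighborhood G w) \<union> critical c w a" for u
  proof (cases "u \<in> neighborhood G w")
    case True
    then have w: "w \<in> neighborhood G u" by (simp add: neighborhood_sym)
    have "odd_colors (c(w := a)) (insert w (neighborhood G u - {w})) = {}
        \<longleftrightarrow> odd_colors (c(w := a)) (neighborhood G u - {w}) = {a}"
      by (subst odd_colors_insert_empty_iff) auto
    moreover have "odd_colors (c(w := a)) (neighborhood G u - {w}) = odd_colors c (neighborhood G u - {w})"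
      by (rule odd_colors_cong) auto
    ultimately show ?thesis
      using True w neighborhood_subset by (auto simp: bad_def critical_def insert_absorb)
  next
    case False
    then have "w \<notin> neighborhood G u" by (simp add: neighborhood_sym)
    then have "odd_colors (c(w := a)) (neighborhood G u) = odd_colors c (neighborhood G u)"
      by (intro odd_colors_cong) auto
    then show ?thesis using False by (auto simp: bad_def critical_def)
  qed
  then show ?thesis by blast
qed

text \<open>A neighbor of \<open>w\<close> determines the single odd color that remains without
  \<open>w\<close>, so the critical sets of different colors are disjoint.\<close>

lemma sum_card_critical_le:
  assumes "finite A"
  shows "(\<Sum>a\<in>A. card (critical c w a)) \<le> card (neighborhood G w)"
proof -
  have "(\<Sum>a\<in>A. card (critical c w a)) = card (\<Union>a\<in>A. critical c w a)"
    using assms by (subst card_UN_disjoint) (auto simp: critical_def)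
  also have "\<dots> \<le> card (neighborhood G w)"
    by (rule card_mono) (auto simp: critical_def)
  finally show ?thesis .
qed

section \<open>Colorings with the fewest bad vertices\<close>

definition optimal :: "nat \<Rightarrow> ('a \<Rightarrow> nat) \<Rightarrow> bool" where
  "optimal k c \<longleftrightarrow> proper_coloring G k c \<and>
     (\<forall>c'. proper_coloring G k c' \<longrightarrow> card (bad c) \<le> card (bad c'))"

lemma ex_optimal:
  assumes "max_degree G < k"
  shows "\<exists>c. optimal k c"
  using ex_has_least_nat[of "proper_coloring G k" _ "card \<circ> bad"] ex_proper_coloring[OF assms]
  by (auto simp: optimal_def)

lemma critical_nonempty:
  assumes "optimal k c" "v \<in> bad c" "v \<in> neighborhood G w" "a < k" "a \<notin> c ` neighborhood G w"
  shows "critical c w a \<noteq> {}"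
proof
  assume "critical c w a = {}"
  then have "bad (c(w := a)) \<subset> bad c" using assms by (auto simp: bad_recolor)
  then have "card (bad (c(w := a))) < card (bad c)" by (simp add: psubset_card_mono)
  then show False using assms proper_coloring_recolor by (auto simp: optimal_def not_less[symmetric])
qed

text \<open>The bad neighbor \<open>v\<close> pays for the one vertex \<open>u\<close> that may
  become bad, so badness moves to \<open>u\<close> at no cost.\<close>

lemma optimal_recolor:
  assumes c: "optimal k c" "v \<in> bad c" "v \<in> neighborhood G w"
    and a: "a < k" "a \<notin> c ` neighborhood G w" "critical c w a = {u}"
  shows "optimal k (c(w := a))"
proof -
  have "card (bad (c(w := a))) \<le> card (bad c - neighborhood G w) + card {u}"
    unfolding bad_recolor a(3) by (rule card_Un_le)
  also have "card (bad c - neighborhood G w) + card {u} \<le> card (bad c)"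
  proof -
    have "bad c - neighborhood G w \<subset> bad c" using c by blast
    then have "card (bad c - neighborhood G w) < card (bad c)" by (simp add: psubset_card_mono)
    then show ?thesis by simp
  qed
  finally show ?thesis
    using c(1) proper_coloring_recolor[OF _ a(1,2)] unfolding optimal_def by (meson le_trans)
qed

text \<open>Each missing color claims a critical neighbor of its own. The number of seen colors
  stays separate from the degree, since it will later be bounded by about half the degree.\<close>

lemma palette_le_near_bad:
  assumes "optimal k c" "v \<in> bad c" "v \<in> neighborhood G w"
  shows "k \<le> card (c ` neighborhood G w) + card (neighborhood G w)"
proof -
  let ?A = "{..<k} - c ` neighborhood G w"
  have "k = card {..<k}" by simp
  also have "\<dots> \<le> card (c ` neighborhood G w) + card ?A"
    by (metis card_Un_le card_mono finite_UnI finite_Diff finite_imageI finite_lessThan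
        finite_neighborhood Un_Diff_cancel Un_upper2 le_trans)
  also have "card ?A \<le> (\<Sum>a\<in>?A. card (critical c w a))"
    unfolding card_eq_sum[of ?A]
  proof (rule sum_mono)
    fix a assume "a \<in> ?A"
    then show "1 \<le> card (critical c w a)"
      using critical_nonempty[OF assms] by (simp add: Suc_le_eq card_gt_0_iff)
  qed
  also have "\<dots> \<le> card (neighborhood G w)" by (rule sum_card_critical_le) simp
  finally show ?thesis by simp
qed

lemma optimal_small_palette:
  assumes "star_free (l + 1) G" "l \<ge> 2" "optimal k c" "v \<in> bad c"
  shows "2 * k \<le> 3 * max_degree G + l"
proof (rule ccontr)
  assume large: "\<not> 2 * k \<le> 3 * max_degree G + l"
  obtain w where "w \<in> neighborhood G v" using assms(4) by (auto simp: bad_def)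
  then have vw: "v \<in> neighborhood G w" by (simp add: neighborhood_sym)
  define C where "C = c ` neighborhood G w"
  define A where "A = {..<k} - C"
  define S where "S = {a \<in> A. card (critical c w a) = 1}"
  have fin: "finite A" "finite S" "finite C" by (simp_all add: A_def S_def C_def)
  define I where "I = (\<Union>a\<in>S. critical c w a)"
  have "card I = (\<Sum>a\<in>S. card (critical c w a))"
    unfolding I_def using fin by (subst card_UN_disjoint) (auto simp: critical_def)
  then have card_I: "card I = card S" by (simp add: S_def)

  \<comment> \<open>If \<open>u\<close> and \<open>u'\<close> in \<open>I\<close> were adjacent, recoloring \<open>w\<close> would move the badness to \<open>u\<close>; its
    neighbor \<open>u'\<close> sees few colors because all but one of them are even there.\<close>
  have indep: "u' \<notin> neighborhood G u" if u: "u \<in> I" "u' \<in> I" for u u'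
  proof
    assume adj: "u' \<in> neighborhood G u"
    obtain a where a: "a \<in> S" "u \<in> critical c w a" using u by (auto simp: I_def)
    obtain a' where a': "u' \<in> critical c w a'" using u by (auto simp: I_def)
    have "critical c w a = {u}" using a by (auto simp: S_def card_1_singleton_iff)
    then have "optimal k (c(w := a))" "u \<in> bad (c(w := a))"
      using a optimal_recolor[OF assms(3,4) vw, of a u] by (auto simp: S_def A_def C_def bad_recolor)
    moreover have "u \<in> neighborhood G u'" using adj by (simp add: neighborhood_sym)
    ultimately have "k \<le> card ((c(w := a)) ` neighborhood G u') + card (neighborhood G u')"
      by (rule palette_le_near_bad)
    \<comment> \<open>The recolored \<open>w\<close> contributes at most the one extra color
      \<open>a\<close>.\<close>
    also have "card ((c(w := a)) ` neighborhood G u') \<le> card (insert a (c ` (neighborhood G u' - {w})))"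
      by (rule card_mono) auto
    also have "\<dots> \<le> Suc (card (c ` (neighborhood G u' - {w})))"
      by (simp add: card_insert_if)
    finally have k: "k \<le> Suc (card (c ` (neighborhood G u' - {w}))) + card (neighborhood G u')"
      by simp
    have "u' \<in> neighborhood G w" using a' by (simp add: critical_def)
    then have "w \<in> neighborhood G u'" by (simp add: neighborhood_sym)
    then have "card (neighborhood G u') = Suc (card (neighborhood G u' - {w}))"
      by (rule card.remove[OF finite_neighborhood])
    moreover have "2 * card (c ` (neighborhood G u' - {w})) \<le> card (neighborhood G u' - {w}) + 1"
      using card_image_odd_colors_le[of "neighborhood G u' - {w}" c] a' by (simp add: critical_def)
    ultimately have "2 * card (c ` (neighborhood G u' - {w})) \<le> card (neighborhood G u')"
      by simp
    \<comment> \<open>With d the degree of \<open>u'\<close>, this gives 2k \<le> 3d + 2, and 2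
      \<le> \<open>l\<close> contradicts \<open>large\<close>.\<close>
    then show False
      using k card_neighborhood_le[of u'] large assms(2) by linarith
  qed
  have "I \<subseteq> neighborhood G w" by (auto simp: I_def critical_def)
  from star_free_card_le[OF assms(1) this indep] have "card S \<le> l" unfolding card_I .
  have "2 * card A = (\<Sum>a\<in>A. 2)" by simp
  \<comment> \<open>Every missing color is charged 2; only those in \<open>S\<close> fall short, by
    1 each.\<close>
  also have "\<dots> \<le> (\<Sum>a\<in>A. card (critical c w a) + (if a \<in> S then 1 else 0))"
  proof (rule sum_mono)
    fix a assume "a \<in> A"
    then have "critical c w a \<noteq> {}"
      using critical_nonempty[OF assms(3,4) vw] by (auto simp: A_def C_def)
    then have "card (critical c w a) > 0" by (simp add: card_gt_0_iff)
    then show "2 \<le> card (critical c w a) + (if a \<in> S then 1 else 0)"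
      using \<open>a \<in> A\<close> by (auto simp: S_def)
  qed
  also have "\<dots> = (\<Sum>a\<in>A. card (critical c w a)) + card S"
  proof -
    have "A \<inter> S = S" by (auto simp: S_def)
    then show ?thesis using fin by (simp add: sum.distrib sum.If_cases)
  qed
  also have "\<dots> \<le> max_degree G + l"
    using \<open>card S \<le> l\<close> sum_card_critical_le[OF fin(1), of c w] card_neighborhood_le[of w] by simp
  finally have "2 * card A \<le> max_degree G + l" .
  moreover have "k \<le> card A + card C"
    using diff_card_le_card_Diff[OF fin(3), of "{..<k}"] by (simp add: A_def)
  moreover have "card C \<le> max_degree G"
    using card_image_le[OF finite_neighborhood, of c w] card_neighborhood_le[of w] by (simp add: C_def)
  ultimately show False using large by linarith
qed

section \<open>Bounds on the odd chromatic number\<close>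

lemma odd_chromatic_number_le:
  assumes "max_degree G < k" "\<And>c v. optimal k c \<Longrightarrow> v \<notin> bad c"
  shows "odd_chromatic_number G \<le> k"
proof -
  obtain c where "optimal k c" using ex_optimal assms(1) by blast
  then have "odd_coloring G k c"
    using assms(2) by (auto simp: odd_coloring_iff_bad_empty optimal_def)
  then show ?thesis unfolding odd_chromatic_number_def by (intro Least_le) blast
qed

lemma odd_chromatic_number_le_twice: "odd_chromatic_number G \<le> 2 * max_degree G + 1"
proof (rule odd_chromatic_number_le)
  fix c v assume c: "optimal (2 * max_degree G + 1) c"
  show "v \<notin> bad c"
  proof
    assume v: "v \<in> bad c"
    then obtain w where "w \<in> neighborhood G v" by (auto simp: bad_def)
    then have "v \<in> neighborhood G w" by (simp add: neighborhood_sym)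
    from palette_le_near_bad[OF c v this] show False
      using card_image_le[OF finite_neighborhood, of c w] card_neighborhood_le[of w] by simp
  qed
qed simp

lemma odd_chromatic_number_star_free_le:
  assumes "star_free (l + 1) G" "l \<ge> 2"
  shows "2 * odd_chromatic_number G \<le> 3 * max_degree G + l + 2"
proof -
  \<comment> \<open>This is the least number of colors that violates the bound of
    \<open>optimal_small_palette\<close>.\<close>
  let ?k = "(3 * max_degree G + l) div 2 + 1"
  have "odd_chromatic_number G \<le> ?k"
  proof (rule odd_chromatic_number_le)
    show "max_degree G < ?k" using assms(2) by linarith
    fix c v assume "optimal ?k c"
    then show "v \<notin> bad c" using optimal_small_palette[OF assms, of ?k c v] by auto
  qed
  then show ?thesis by linarith
qed

end

theorem theorem1p8:
  fixes G :: "('a, 'b) pre_digraph" and l :: nat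
  assumes "l \<ge> 2"
    and "graph G"
    and "star_free (l + 1) G"
  shows "real (odd_chromatic_number G)
    \<le> (2 * real l - 1) / real l * real (max_degree G) + 1
      + real_of_int \<lceil>sqrt (2 * real (max_degree G) / real l + 1)\<rceil>"
proof -
  interpret graph G by fact
  define D where "D = real (max_degree G)"
  define x where "x = D / l"
  have l: "real l \<ge> 2" using assms(1) by simp
  then have D: "D = l * x" "x \<ge> 0" by (simp_all add: x_def D_def)
  have "1 \<le> sqrt (2 * x + 1)" using D(2) by simp
  then have s: "1 \<le> real_of_int \<lceil>sqrt (2 * x + 1)\<rceil>" by linarith
  \<comment> \<open>The rounded root is replaced by its lower bound 1; the bound 2D + 1 then
    suffices exactly when x \<le> 1.\<close>
  have "real (odd_chromatic_number G) \<le> 2 * D - x + 1 + 1"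
  proof (cases "x \<le> 1")
    case True
    moreover have "real (odd_chromatic_number G) \<le> 2 * D + 1"
      using odd_chromatic_number_le_twice by (simp add: D_def flip: of_nat_le_iff)
    ultimately show ?thesis by simp
  next
    case False
    have "2 * real (odd_chromatic_number G) \<le> 3 * D + l + 2"
      using odd_chromatic_number_star_free_le[OF assms(3,1)] by (simp add: D_def flip: of_nat_le_iff)
    \<comment> \<open>As D = lx, this product is the difference between twice the target, 4D - 2x +
      4, and 3D + l + 2.\<close>
    moreover have "(real l - 2) * (x - 1) \<ge> 0" using False l by simp
    ultimately show ?thesis using D(1) by (simp add: algebra_simps)
  qed
  then have "real (odd_chromatic_number G) \<le> 2 * D - x + 1 + real_of_int \<lceil>sqrt (2 * x + 1)\<rceil>"
    using s by linarith
  moreover have "(2 * real l - 1) / real l * D = 2 * D - x"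
    using l by (simp add: x_def field_simps)
  moreover have "2 * D / real l = 2 * x" by (simp add: x_def)
  ultimately show ?thesis by (simp only: D_def)
qed

end
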